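(* Let $C \colon \mathbf{Bij}\to\mathbf{Set}$ be a species and $$F(X)=\sum_{n=0}^\infty X^n\otimes_{S_n}C(n)$$ the corresponding analytic functor. Then there is an isomorphism of functors $$\Delta[F](X)\cong\sum_{n=0}^\infty X^n\otimes_{S_n}\Bigl(\sum_{l=n+1}^\infty C(l)_n\Bigr).$$
   Context: $\mathbf{Bij}$ is the category of finite cardinals and bijections; a species is a functor $C \colon \mathbf{Bij}\to\mathbf{Set}$, i.e. a sequence of left $S_n$-sets $C(n)$, $n\ge0$. For a left $S_n$-set $C$, $X^n\otimes_{S_n}C$ is the quotient of $X^n\times C$ by the equivalence relation $(x_1,\dots,x_n;c)\sim(y_1,\dots,y_n;d)$ iff there is $\sigma\in S_n$ with $y_i=x_{\sigma i}$ for all $i$ and $c=\sigma d$. It is functorial in $X$. Analytic functors are taut, i.e. preserve pullback squares in which one leg is a monomorphism. For a left $S_l$-set $C$ and $0\le k<l$, $C_k$ denotes the left $S_k$-set defined as follows: $C_k$ is the set of equivalence classes $[c]$ of elements $c\in C$, where $c\sim d$ iff there is $\sigma\in S_l$ with $\sigma(i)=i$ for all $i\le k$ and $c=\sigma d$; and $\tau\in S_k$ acts by $\tau[c]=[\bar\tau c]$, where $\bar\tau\in S_l$ extends $\tau$ by the identity on $i>k$. $C(l)_n$ is this construction applied to the $S_l$-set $C(l)$ with $k=n$. For a taut functor $F \colon \mathbf{Set}\to\mathbf{Set}$, with $j_X \colon X\to X+1$ the coproduct injection, $\Delta[F](X)=F(X+1)\setminus\mathrm{Im}\,F(j_X)$,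 and $\Delta[F](f)$ is the restriction of $F(f+1)$ (which does restrict, because $F$ is taut). $\sum$ denotes coproduct. *)

theory Defs
  imports "HOL-Algebra.Sym_Groups" "HOL-Algebra.Group_Action"
begin

section \<open>Functors from sets to sets\<close>

text \<open>
  The category of sets is rendered over a universe type: the objects are all sets
  \<open>X :: 'a set\<close>, and the morphisms from \<open>X\<close> to \<open>Y\<close> are the elements of \<open>X \<rightarrow>\<^sub>E Y\<close>. A functor
  consists of an object map \<open>F\<close> and a morphism map \<open>Fm\<close>, where \<open>Fm X Y f\<close> is the image of
  \<open>f \<in> X \<rightarrow>\<^sub>E Y\<close>. Statements about functors are to be read as holding for every type \<open>'a\<close>.
\<close>

definition set_functor ::
  "('a set \<Rightarrow> 'p set) \<Rightarrow> ('a set \<Rightarrow> 'a set \<Rightarrow> ('a \<Rightarrow> 'a) \<Rightarrow> 'p \<Rightarrow> 'p) \<Rightarrow> bool"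
  where "set_functor F Fm \<longleftrightarrow>
    (\<forall>X Y. \<forall>f \<in> X \<rightarrow>\<^sub>E Y. Fm X Y f \<in> F X \<rightarrow>\<^sub>E F Y) \<and>
    (\<forall>X. Fm X X (\<lambda>x\<in>X. x) = (\<lambda>p\<in>F X. p)) \<and>
    (\<forall>X Y Z. \<forall>f \<in> X \<rightarrow>\<^sub>E Y. \<forall>g \<in> Y \<rightarrow>\<^sub>E Z.
       Fm X Z (compose X g f) = compose (F X) (Fm Y Z g) (Fm X Y f))"

definition natural_iso ::
  "('a set \<Rightarrow> 'p set) \<Rightarrow> ('a set \<Rightarrow> 'a set \<Rightarrow> ('a \<Rightarrow> 'a) \<Rightarrow> 'p \<Rightarrow> 'p) \<Rightarrow>
   ('a set \<Rightarrow> 'q set) \<Rightarrow> ('a set \<Rightarrow> 'a set \<Rightarrow> ('a \<Rightarrow> 'a) \<Rightarrow> 'q \<Rightarrow> 'q) \<Rightarrow>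
   ('a set \<Rightarrow> 'p \<Rightarrow> 'q) \<Rightarrow> bool"
  where "natural_iso F Fm G Gm \<theta> \<longleftrightarrow>
    (\<forall>X. bij_betw (\<theta> X) (F X) (G X)) \<and>
    (\<forall>X Y. \<forall>f \<in> X \<rightarrow>\<^sub>E Y. \<forall>p \<in> F X. \<theta> Y (Fm X Y f p) = Gm X Y f (\<theta> X p))"

definition isomorphic_functors ::
  "('a set \<Rightarrow> 'p set) \<Rightarrow> ('a set \<Rightarrow> 'a set \<Rightarrow> ('a \<Rightarrow> 'a) \<Rightarrow> 'p \<Rightarrow> 'p) \<Rightarrow>
   ('a set \<Rightarrow> 'q set) \<Rightarrow> ('a set \<Rightarrow> 'a set \<Rightarrow> ('a \<Rightarrow> 'a) \<Rightarrow> 'q \<Rightarrow> 'q) \<Rightarrow> bool"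
  where "isomorphic_functors F Fm G Gm \<longleftrightarrow>
    set_functor F Fm \<and> set_functor G Gm \<and> (\<exists>\<theta>. natural_iso F Fm G Gm \<theta>)"


section \<open>The difference of a functor\<close>

text \<open>
  The set \<open>X + 1\<close> is \<open>X <+> {()}\<close>, of type \<open>('a + unit) set\<close>. Hence the difference of a functor
  uses that functor at several types, and its instances are separate arguments below:
  \<open>F\<close> is the object map on sets over \<open>'a\<close>, \<open>F1\<close> the one on sets over \<open>'a + unit\<close>,
  \<open>Fj\<close> the morphism map for functions from \<open>'a\<close> to \<open>'a + unit\<close>, and \<open>F1m\<close> the one for
  functions from \<open>'a + unit\<close> to \<open>'b + unit\<close>.
\<close>

abbreviation plus_one :: "'a set \<Rightarrow> ('a + unit) set"
  where "plus_one X \<equiv> X <+> {()}"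

definition difference ::
  "(('a + unit) set \<Rightarrow> 'p set) \<Rightarrow> ('a set \<Rightarrow> 'q set) \<Rightarrow>
   ('a set \<Rightarrow> ('a + unit) set \<Rightarrow> ('a \<Rightarrow> 'a + unit) \<Rightarrow> 'q \<Rightarrow> 'p) \<Rightarrow> 'a set \<Rightarrow> 'p set"
  where "difference F1 F Fj X = F1 (plus_one X) - Fj X (plus_one X) (\<lambda>x\<in>X. Inl x) ` F X"

definition difference_map ::
  "(('a + unit) set \<Rightarrow> 'p set) \<Rightarrow> ('a set \<Rightarrow> 'q set) \<Rightarrow>
   ('a set \<Rightarrow> ('a + unit) set \<Rightarrow> ('a \<Rightarrow> 'a + unit) \<Rightarrow> 'q \<Rightarrow> 'p) \<Rightarrow>
   (('a + unit) set \<Rightarrow> ('b + unit) set \<Rightarrow> ('a + unit \<Rightarrow> 'b + unit) \<Rightarrow> 'p \<Rightarrow> 'r) \<Rightarrow>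
   'a set \<Rightarrow> 'b set \<Rightarrow> ('a \<Rightarrow> 'b) \<Rightarrow> 'p \<Rightarrow> 'r"
  where "difference_map F1 F Fj F1m X Y f =
    restrict (F1m (plus_one X) (plus_one Y) (\<lambda>z\<in>plus_one X. map_sum f id z))
      (difference F1 F Fj X)"


section \<open>Species and analytic functors\<close>

definition species :: "(nat \<Rightarrow> 'c set) \<Rightarrow> (nat \<Rightarrow> (nat \<Rightarrow> nat) \<Rightarrow> 'c \<Rightarrow> 'c) \<Rightarrow> bool"
  where "species C act \<longleftrightarrow> (\<forall>n. group_action (sym_group n) (C n) (act n))"

text \<open>In this section a single symmetric set is given by a degree \<open>n\<close>, a set \<open>C\<close> and an action
  \<open>\<phi>\<close>. The power \<open>X\<^sup>n\<close> is \<open>{1..n} \<rightarrow>\<^sub>E X\<close>.\<close>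

definition tensor_rel ::
  "nat \<Rightarrow> 'c set \<Rightarrow> ((nat \<Rightarrow> nat) \<Rightarrow> 'c \<Rightarrow> 'c) \<Rightarrow> 'a set \<Rightarrow> (((nat \<Rightarrow> 'a) \<times> 'c) rel)"
  where "tensor_rel n C \<phi> X =
    {((x, c), (y, d)). x \<in> {1..n} \<rightarrow>\<^sub>E X \<and> c \<in> C \<and> y \<in> {1..n} \<rightarrow>\<^sub>E X \<and> d \<in> C \<and>
       (\<exists>\<sigma> \<in> carrier (sym_group n). (\<forall>i\<in>{1..n}. y i = x (\<sigma> i)) \<and> c = \<phi> \<sigma> d)}"

definition tensor ::
  "nat \<Rightarrow> 'c set \<Rightarrow> ((nat \<Rightarrow> nat) \<Rightarrow> 'c \<Rightarrow> 'c) \<Rightarrow> 'a set \<Rightarrow> ((nat \<Rightarrow> 'a) \<times> 'c) set set"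
  where "tensor n C \<phi> X = (({1..n} \<rightarrow>\<^sub>E X) \<times> C) // tensor_rel n C \<phi> X"

text \<open>The class of \<open>(x, c)\<close> is sent to the class of \<open>(f \<circ> x, c)\<close>.\<close>

definition tensor_map ::
  "nat \<Rightarrow> 'c set \<Rightarrow> ((nat \<Rightarrow> nat) \<Rightarrow> 'c \<Rightarrow> 'c) \<Rightarrow> 'a set \<Rightarrow> 'b set \<Rightarrow> ('a \<Rightarrow> 'b) \<Rightarrow>
   ((nat \<Rightarrow> 'a) \<times> 'c) set \<Rightarrow> ((nat \<Rightarrow> 'b) \<times> 'c) set"
  where "tensor_map n C \<phi> X Y f =
    (\<lambda>K \<in> tensor n C \<phi> X. tensor_rel n C \<phi> Y `` ((\<lambda>(x, c). (compose {1..n} f x, c)) ` K))"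

definition analytic ::
  "(nat \<Rightarrow> 'c set) \<Rightarrow> (nat \<Rightarrow> (nat \<Rightarrow> nat) \<Rightarrow> 'c \<Rightarrow> 'c) \<Rightarrow> 'a set \<Rightarrow>
   (nat \<times> ((nat \<Rightarrow> 'a) \<times> 'c) set) set"
  where "analytic C act X = (SIGMA n:UNIV. tensor n (C n) (act n) X)"

definition analytic_map ::
  "(nat \<Rightarrow> 'c set) \<Rightarrow> (nat \<Rightarrow> (nat \<Rightarrow> nat) \<Rightarrow> 'c \<Rightarrow> 'c) \<Rightarrow> 'a set \<Rightarrow> 'b set \<Rightarrow> ('a \<Rightarrow> 'b) \<Rightarrow>
   nat \<times> ((nat \<Rightarrow> 'a) \<times> 'c) set \<Rightarrow> nat \<times> ((nat \<Rightarrow> 'b) \<times> 'c) set"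
  where "analytic_map C act X Y f =
    (\<lambda>(n, K) \<in> analytic C act X. (n, tensor_map n (C n) (act n) X Y f K))"


section \<open>The species of the difference\<close>

text \<open>Below, \<open>C\<close> with action \<open>\<phi>\<close> is a set acted on by the symmetric group of degree \<open>l\<close>, and
  \<open>k < l\<close>. Elements of \<open>sym_group k\<close> are functions on all natural numbers that fix every number
  outside \<open>{1..k}\<close>, so that the extension by the identity of \<open>\<tau> \<in> carrier (sym_group k)\<close> to an
  element of \<open>sym_group l\<close> is \<open>\<tau>\<close> itself.\<close>

definition tail_rel ::
  "nat \<Rightarrow> 'c set \<Rightarrow> ((nat \<Rightarrow> nat) \<Rightarrow> 'c \<Rightarrow> 'c) \<Rightarrow> nat \<Rightarrow> 'c rel"
  where "tail_rel l C \<phi> k =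
    {(c, d). c \<in> C \<and> d \<in> C \<and>
       (\<exists>\<sigma> \<in> carrier (sym_group l). (\<forall>i\<in>{1..k}. \<sigma> i = i) \<and> c = \<phi> \<sigma> d)}"

definition tail_quotient ::
  "nat \<Rightarrow> 'c set \<Rightarrow> ((nat \<Rightarrow> nat) \<Rightarrow> 'c \<Rightarrow> 'c) \<Rightarrow> nat \<Rightarrow> 'c set set"
  where "tail_quotient l C \<phi> k = C // tail_rel l C \<phi> k"

definition tail_action ::
  "nat \<Rightarrow> 'c set \<Rightarrow> ((nat \<Rightarrow> nat) \<Rightarrow> 'c \<Rightarrow> 'c) \<Rightarrow> nat \<Rightarrow> (nat \<Rightarrow> nat) \<Rightarrow> 'c set \<Rightarrow> 'c set"
  where "tail_action l C \<phi> k \<tau> =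
    (\<lambda>K \<in> tail_quotient l C \<phi> k. tail_rel l C \<phi> k `` (\<phi> \<tau> ` K))"

definition difference_species ::
  "(nat \<Rightarrow> 'c set) \<Rightarrow> (nat \<Rightarrow> (nat \<Rightarrow> nat) \<Rightarrow> 'c \<Rightarrow> 'c) \<Rightarrow> nat \<Rightarrow> (nat \<times> 'c set) set"
  where "difference_species C act n = (SIGMA l:{n<..}. tail_quotient l (C l) (act l) n)"

definition difference_action ::
  "(nat \<Rightarrow> 'c set) \<Rightarrow> (nat \<Rightarrow> (nat \<Rightarrow> nat) \<Rightarrow> 'c \<Rightarrow> 'c) \<Rightarrow> nat \<Rightarrow> (nat \<Rightarrow> nat) \<Rightarrow>
   nat \<times> 'c set \<Rightarrow> nat \<times> 'c set"
  where "difference_action C act n \<tau> =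
    (\<lambda>(l, K) \<in> difference_species C act n. (l, tail_action l (C l) (act l) n \<tau> K))"

end

theory Submission
  imports Defs
begin

text \<open>
  A pair of functors that are both quotients of one functor by the same congruence are isomorphic.
  Here the common functor sends \<open>X\<close> to the set of all \<open>(n, l, x, c)\<close> with \<open>n < l\<close>,
  \<open>x \<in> X\<^sup>n\<close> and \<open>c \<in> C(l)\<close>. Padding \<open>x\<close> to the right by the added point represents an element
  of \<open>\<Delta>[F](X)\<close>, and every element is so represented after a permutation that moves the
  coordinates equal to the added point to the end. A permutation relating two padded tuples preserves
  \<open>{1..n}\<close>, so it is a product \<open>\<rho> \<circ> \<tau>\<close> with \<open>\<tau> \<in> S\<^sub>n\<close> and \<open>\<rho>\<close> the identity on \<open>{1..n}\<close>;
  this is the identification made by the tensor product with \<open>C(l)\<^sub>n\<close>.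
\<close>

text \<open>Keeps the simplifier from rewriting \<open>1\<close> to \<open>Suc 0\<close> in the
  index sets \<open>{1..n}\<close>.\<close>

declare One_nat_def [simp del]

section \<open>Functors presented as quotients of a common functor\<close>

text \<open>By \<open>ker\<close> the surjections \<open>p X\<close> and \<open>q X\<close> have the
  same fibres, so matching \<open>p X a\<close> with \<open>q X a\<close> is a well-defined
  bijection. Functoriality and naturality are then checked on representatives, where both morphism
  maps are induced by \<open>m\<close>. Extensionality settles the values outside \<open>F X\<close>
  and \<open>G X\<close>.\<close>

lemma isomorphic_functorsI:
  fixes F :: "'a set \<Rightarrow> 'p set" and G :: "'a set \<Rightarrow> 'q set" and A :: "'a set \<Rightarrow> 'r set"
  assumes F: "\<And>X. F X = p X ` A X" and G: "\<And>X. G X = q X ` A X"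
    and ker: "\<And>X a b. a \<in> A X \<Longrightarrow> b \<in> A X \<Longrightarrow> p X a = p X b \<longleftrightarrow> q X a = q X b"
    and A: "\<And>X Y f a. f \<in> X \<rightarrow>\<^sub>E Y \<Longrightarrow> a \<in> A X \<Longrightarrow> m f a \<in> A Y"
    and A_id: "\<And>X a. a \<in> A X \<Longrightarrow> m (\<lambda>x\<in>X. x) a = a"
    and A_comp: "\<And>X Y Z f g a. f \<in> X \<rightarrow>\<^sub>E Y \<Longrightarrow> g \<in> Y \<rightarrow>\<^sub>E Z \<Longrightarrow> a \<in> A X \<Longrightarrow>
      m (compose X g f) a = m g (m f a)"
    and F_ext: "\<And>X Y f. Fm X Y f \<in> extensional (F X)"
    and G_ext: "\<And>X Y f. Gm X Y f \<in> extensional (G X)"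
    and Fm: "\<And>X Y f a. f \<in> X \<rightarrow>\<^sub>E Y \<Longrightarrow> a \<in> A X \<Longrightarrow> Fm X Y f (p X a) = p Y (m f a)"
    and Gm: "\<And>X Y f a. f \<in> X \<rightarrow>\<^sub>E Y \<Longrightarrow> a \<in> A X \<Longrightarrow> Gm X Y f (q X a) = q Y (m f a)"
  shows "isomorphic_functors F Fm G Gm"
proof -
  \<comment> \<open>Stated for any quotient \<open>H\<close> of \<open>A\<close>, at any result
    type, so that it serves \<open>F\<close> and \<open>G\<close> alike.\<close>
  have functorial: "set_functor H Hm"
    if H: "\<And>X. H X = r X ` A X" and ext: "\<And>X Y f. Hm X Y f \<in> extensional (H X)"
      and Hm: "\<And>X Y f a. f \<in> X \<rightarrow>\<^sub>E Y \<Longrightarrow> a \<in> A X \<Longrightarrow> Hm X Y f (r X a) = r Y (m f a)"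
    for H :: "'a set \<Rightarrow> 's set" and r Hm
    unfolding set_functor_def
  proof (intro conjI allI ballI)
    fix X Y and f :: "'a \<Rightarrow> 'a" assume f: "f \<in> X \<rightarrow>\<^sub>E Y"
    then show "Hm X Y f \<in> H X \<rightarrow>\<^sub>E H Y"
      using ext by (auto simp: PiE_def H Hm A)
  next
    fix X
    show "Hm X X (\<lambda>x\<in>X. x) = (\<lambda>p\<in>H X. p)"
      by (rule extensionalityI[OF ext]) (auto simp: H Hm A_id)
  next
    fix X Y Z and f g :: "'a \<Rightarrow> 'a" assume f: "f \<in> X \<rightarrow>\<^sub>E Y" and g: "g \<in> Y \<rightarrow>\<^sub>E Z"
    then have "compose X g f \<in> X \<rightarrow>\<^sub>E Z"
      by (auto simp: compose_def)
    with f g show "Hm X Z (compose X g f) = compose (H X) (Hm Y Z g) (Hm X Y f)"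
      by (intro extensionalityI[OF ext compose_extensional])
        (auto simp: H Hm A A_comp compose_eq)
  qed
  \<comment> \<open>\<open>inv_into\<close> picks some representative of a point of
    \<open>F X\<close>; by \<open>ker\<close> its image under \<open>q X\<close> does not depend on
    the choice.\<close>
  define \<theta> where "\<theta> X = q X \<circ> inv_into (A X) (p X)" for X
  have \<theta>: "\<theta> X (p X a) = q X a" if "a \<in> A X" for X a
    using that ker[of "inv_into (A X) (p X) (p X a)" X a]
    by (simp add: \<theta>_def inv_into_into f_inv_into_f)
  have "natural_iso F Fm G Gm \<theta>"
    unfolding natural_iso_def
  proof (intro conjI allI ballI)
    fix X
    show "bij_betw (\<theta> X) (F X) (G X)"
      by (auto simp: bij_betw_def inj_on_def F G \<theta> ker image_image)
  next
    fix X Y and f :: "'a \<Rightarrow> 'a" and u assume "f \<in> X \<rightarrow>\<^sub>E Y" "u \<in> F X"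
    then show "\<theta> Y (Fm X Y f u) = Gm X Y f (\<theta> X u)"
      by (auto simp: F Fm Gm \<theta> A)
  qed
  with functorial[OF F F_ext Fm] functorial[OF G G_ext Gm] show ?thesis
    by (auto simp: isomorphic_functors_def)
qed

subsection \<open>Actions of symmetric groups\<close>

text \<open>A \<open>group_action\<close> is a homomorphism into a group of extensional bijections.
  The arguments below need only these pointwise laws on \<open>C\<close>, phrased with
  \<open>permutes\<close>; they are also easier to verify for the difference species.\<close>

locale sym_action =
  fixes n :: nat and C :: "'c set" and \<phi> :: "(nat \<Rightarrow> nat) \<Rightarrow> 'c \<Rightarrow> 'c"
  assumes closed: "\<sigma> permutes {1..n} \<Longrightarrow> c \<in> C \<Longrightarrow> \<phi> \<sigma> c \<in> C"
    and id_act: "c \<in> C \<Longrightarrow> \<phi> id c = c"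
    and comp_act: "\<sigma> permutes {1..n} \<Longrightarrow> \<tau> permutes {1..n} \<Longrightarrow> c \<in> C \<Longrightarrow> \<phi> (\<sigma> \<circ> \<tau>) c = \<phi> \<sigma> (\<phi> \<tau> c)"

lemma sym_action_of_group_action:
  assumes "group_action (sym_group n) C \<phi>"
  shows "sym_action n C \<phi>"
proof -
  interpret group_action "sym_group n" C \<phi> by fact
  show ?thesis
  proof
    fix \<sigma> c assume "\<sigma> permutes {1..n}" "c \<in> C"
    then show "\<phi> \<sigma> c \<in> C"
      using element_image[of \<sigma> c] by (simp add: sym_group_carrier)
  next
    fix c assume "c \<in> C"
    then show "\<phi> id c = c"
      using id_eq_one by (simp add: sym_group_one) (metis restrict_apply')
  next
    fix \<sigma> \<tau> c assume "\<sigma> permutes {1..n}" "\<tau> permutes {1..n}" "c \<in> C"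
    then show "\<phi> (\<sigma> \<circ> \<tau>) c = \<phi> \<sigma> (\<phi> \<tau> c)"
      using composition_rule[of c \<sigma> \<tau>] by (simp add: sym_group_carrier sym_group_mult)
  qed
qed

context sym_action
begin

lemma inv_act:
  assumes "\<sigma> permutes {1..n}" "c \<in> C"
  shows "\<phi> (inv' \<sigma>) (\<phi> \<sigma> c) = c"
  using comp_act[of "inv' \<sigma>" \<sigma> c] assms by (simp add: permutes_inv permutes_inv_o id_act)

lemma equiv_tensor_rel: "equiv (({1..n} \<rightarrow>\<^sub>E X) \<times> C) (tensor_rel n C \<phi> X)"
proof (rule equivI)
  show "tensor_rel n C \<phi> X \<subseteq> (({1..n} \<rightarrow>\<^sub>E X) \<times> C) \<times> (({1..n} \<rightarrow>\<^sub>E X) \<times> C)"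
    by (auto simp: tensor_rel_def)
  show "refl_on (({1..n} \<rightarrow>\<^sub>E X) \<times> C) (tensor_rel n C \<phi> X)"
    by (auto simp: refl_on_def tensor_rel_def sym_group_carrier id_act permutes_id
        intro!: bexI[of _ id])
  show "sym (tensor_rel n C \<phi> X)"
  proof (rule symI, clarify)
    fix x y c d assume "((x, c), (y, d)) \<in> tensor_rel n C \<phi> X"
    then obtain \<sigma> where xy: "x \<in> {1..n} \<rightarrow>\<^sub>E X" "y \<in> {1..n} \<rightarrow>\<^sub>E X" "c \<in> C" "d \<in> C"
      and \<sigma>: "\<sigma> permutes {1..n}" "\<forall>i\<in>{1..n}. y i = x (\<sigma> i)" "c = \<phi> \<sigma> d"
      by (auto simp: tensor_rel_def sym_group_carrier)
    have "x i = y (inv' \<sigma> i)" if "i \<in> {1..n}" for i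
      using \<sigma> that permutes_in_image[OF permutes_inv[OF \<sigma>(1)], of i]
      by (simp add: permutes_inverses)
    with xy \<sigma> show "((y, d), (x, c)) \<in> tensor_rel n C \<phi> X"
      by (auto simp: tensor_rel_def sym_group_carrier permutes_inv inv_act
          intro!: bexI[of _ "inv' \<sigma>"])
  qed
  show "trans (tensor_rel n C \<phi> X)"
  proof (rule transI, clarify)
    fix x y z b c d
    assume "((x, b), (y, c)) \<in> tensor_rel n C \<phi> X" "((y, c), (z, d)) \<in> tensor_rel n C \<phi> X"
    then obtain \<sigma> \<tau> where xy: "x \<in> {1..n} \<rightarrow>\<^sub>E X" "z \<in> {1..n} \<rightarrow>\<^sub>E X" "b \<in> C" "d \<in> C"
      and \<sigma>: "\<sigma> permutes {1..n}" "\<forall>i\<in>{1..n}. y i = x (\<sigma> i)" "b = \<phi> \<sigma> c"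
      and \<tau>: "\<tau> permutes {1..n}" "\<forall>i\<in>{1..n}. z i = y (\<tau> i)" "c = \<phi> \<tau> d"
      by (auto simp: tensor_rel_def sym_group_carrier)
    \<comment> \<open>Reindexing tuples and acting on \<open>C\<close> compose in the same order, so
      the single permutation \<open>\<sigma> \<circ> \<tau>\<close> serves both components.\<close>
    have "z i = x ((\<sigma> \<circ> \<tau>) i)" if "i \<in> {1..n}" for i
      using \<sigma>(2) \<tau>(2) that permutes_in_image[OF \<tau>(1), of i] by simp
    with xy \<sigma> \<tau> show "((x, b), (z, d)) \<in> tensor_rel n C \<phi> X"
      by (auto simp: tensor_rel_def sym_group_carrier permutes_compose comp_act
          intro!: bexI[of _ "\<sigma> \<circ> \<tau>"])
  qed
qed

lemma tensor_class_eq_iff: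
  assumes "x \<in> {1..n} \<rightarrow>\<^sub>E X" "y \<in> {1..n} \<rightarrow>\<^sub>E X" "c \<in> C" "d \<in> C"
  shows "tensor_rel n C \<phi> X `` {(x, c)} = tensor_rel n C \<phi> X `` {(y, d)} \<longleftrightarrow>
    (\<exists>\<sigma>. \<sigma> permutes {1..n} \<and> (\<forall>i\<in>{1..n}. y i = x (\<sigma> i)) \<and> c = \<phi> \<sigma> d)"
proof -
  have "tensor_rel n C \<phi> X `` {(x, c)} = tensor_rel n C \<phi> X `` {(y, d)} \<longleftrightarrow>
    ((x, c), (y, d)) \<in> tensor_rel n C \<phi> X"
    using assms by (intro eq_equiv_class_iff[OF equiv_tensor_rel]) auto
  with assms show ?thesis
    by (auto simp: tensor_rel_def sym_group_carrier)
qed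

text \<open>Permutations act on indices and \<open>f\<close> acts on values, so a permutation
  relating two pairs still relates their images. Hence all members of a class yield the same class
  over \<open>Y\<close>.\<close>

lemma tensor_map_class:
  assumes f: "f \<in> X \<rightarrow> Y" and x: "x \<in> {1..n} \<rightarrow>\<^sub>E X" and c: "c \<in> C"
  shows "tensor_map n C \<phi> X Y f (tensor_rel n C \<phi> X `` {(x, c)}) =
    tensor_rel n C \<phi> Y `` {(compose {1..n} f x, c)}"
proof -
  let ?K = "tensor_rel n C \<phi> X `` {(x, c)}" and ?h = "\<lambda>(x, c). (compose {1..n} f x, c)"
  let ?E = "\<lambda>u. tensor_rel n C \<phi> Y `` {u}"
  have K: "?K \<in> tensor n C \<phi> X"
    using x c by (auto simp: tensor_def intro: quotientI)
  have mem: "(x, c) \<in> ?K"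
    using x c by (intro equiv_class_self[OF equiv_tensor_rel]) auto
  have comp: "compose {1..n} f z \<in> {1..n} \<rightarrow>\<^sub>E Y" if "z \<in> {1..n} \<rightarrow>\<^sub>E X" for z
    using that f by (auto simp: compose_def PiE_def Pi_def)
  have "?E (?h u) = ?E (?h (x, c))" if "u \<in> ?K" for u
  proof -
    obtain y d \<sigma> where u: "u = (y, d)" "y \<in> {1..n} \<rightarrow>\<^sub>E X" "d \<in> C"
      and \<sigma>: "\<sigma> permutes {1..n}" "\<forall>i\<in>{1..n}. y i = x (\<sigma> i)" "c = \<phi> \<sigma> d"
      using \<open>u \<in> ?K\<close> by (auto simp: tensor_rel_def sym_group_carrier)
    have "compose {1..n} f y i = compose {1..n} f x (\<sigma> i)" if "i \<in> {1..n}" for i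
      using \<sigma>(2) that permutes_in_image[OF \<sigma>(1), of i] by (simp add: compose_def)
    with \<sigma> have "?E (compose {1..n} f x, c) = ?E (compose {1..n} f y, d)"
      by (subst tensor_class_eq_iff) (use u x c comp in auto)
    then show ?thesis by (simp add: u)
  qed
  \<comment> \<open>The saturation of the image is a union of classes that all coincide;
    \<open>mem\<close> makes the union nonempty, so it is that one class.\<close>
  moreover have "tensor_rel n C \<phi> Y `` (?h ` ?K) = (\<Union>u\<in>?K. ?E (?h u))"
    by blast
  ultimately have "tensor_rel n C \<phi> Y `` (?h ` ?K) = ?E (?h (x, c))"
    using mem by blast
  with K show ?thesis by (simp add: tensor_map_def)
qed

end

subsection \<open>The species of the difference\<close>

locale tail_sym_action = sym_action l C \<phi> for l and C :: "'c set" and \<phi> +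
  fixes k :: nat
  assumes less: "k < l"
begin

lemma permutes_tail: "\<tau> permutes {1..k} \<Longrightarrow> \<tau> permutes {1..l}"
  using less by (auto intro: permutes_subset)

lemma equiv_tail_rel: "equiv C (tail_rel l C \<phi> k)"
proof (rule equivI)
  show "tail_rel l C \<phi> k \<subseteq> C \<times> C"
    by (auto simp: tail_rel_def)
  show "refl_on C (tail_rel l C \<phi> k)"
    by (auto simp: refl_on_def tail_rel_def sym_group_carrier id_act permutes_id
        intro!: bexI[of _ id])
  show "sym (tail_rel l C \<phi> k)"
  proof (rule symI)
    fix c d assume "(c, d) \<in> tail_rel l C \<phi> k"
    then obtain \<sigma> where cd: "c \<in> C" "d \<in> C"
      and \<sigma>: "\<sigma> permutes {1..l}" "\<forall>i\<in>{1..k}. \<sigma> i = i" "c = \<phi> \<sigma> d"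
      by (auto simp: tail_rel_def sym_group_carrier)
    have "inv' \<sigma> i = i" if "i \<in> {1..k}" for i
      using \<sigma> that by (metis permutes_inv_eq)
    with cd \<sigma> show "(d, c) \<in> tail_rel l C \<phi> k"
      by (auto simp: tail_rel_def sym_group_carrier permutes_inv inv_act
          intro!: bexI[of _ "inv' \<sigma>"])
  qed
  show "trans (tail_rel l C \<phi> k)"
  proof (rule transI)
    fix b c d assume "(b, c) \<in> tail_rel l C \<phi> k" "(c, d) \<in> tail_rel l C \<phi> k"
    then obtain \<sigma> \<tau> where cd: "b \<in> C" "d \<in> C"
      and \<sigma>: "\<sigma> permutes {1..l}" "\<forall>i\<in>{1..k}. \<sigma> i = i" "b = \<phi> \<sigma> c"
      and \<tau>: "\<tau> permutes {1..l}" "\<forall>i\<in>{1..k}. \<tau> i = i" "c = \<phi> \<tau> d"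
      by (auto simp: tail_rel_def sym_group_carrier)
    then show "(b, d) \<in> tail_rel l C \<phi> k"
      by (auto simp: tail_rel_def sym_group_carrier permutes_compose comp_act
          intro!: bexI[of _ "\<sigma> \<circ> \<tau>"])
  qed
qed

lemma tail_class_eq_iff:
  assumes "c \<in> C" "d \<in> C"
  shows "tail_rel l C \<phi> k `` {c} = tail_rel l C \<phi> k `` {d} \<longleftrightarrow>
    (\<exists>\<sigma>. \<sigma> permutes {1..l} \<and> (\<forall>i\<in>{1..k}. \<sigma> i = i) \<and> c = \<phi> \<sigma> d)"
proof -
  have "tail_rel l C \<phi> k `` {c} = tail_rel l C \<phi> k `` {d} \<longleftrightarrow> (c, d) \<in> tail_rel l C \<phi> k"
    using assms by (intro eq_equiv_class_iff[OF equiv_tail_rel])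
  with assms show ?thesis
    by (auto simp: tail_rel_def sym_group_carrier)
qed

lemma tail_quotientE:
  assumes "K \<in> tail_quotient l C \<phi> k"
  obtains c where "c \<in> C" "K = tail_rel l C \<phi> k `` {c}"
  using assms by (auto simp: tail_quotient_def elim: quotientE)

lemma tail_class_in: "c \<in> C \<Longrightarrow> tail_rel l C \<phi> k `` {c} \<in> tail_quotient l C \<phi> k"
  by (auto simp: tail_quotient_def intro: quotientI)

text \<open>The action descends to classes because \<open>S\<^sub>k\<close> normalizes the pointwise stabilizer of
  \<open>{1..k}\<close> in \<open>S\<^sub>l\<close>.\<close>

lemma tail_action_class:
  assumes \<tau>: "\<tau> permutes {1..k}" and c: "c \<in> C"
  shows "tail_action l C \<phi> k \<tau> (tail_rel l C \<phi> k `` {c}) = tail_rel l C \<phi> k `` {\<phi> \<tau> c}"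
proof -
  let ?E = "\<lambda>u. tail_rel l C \<phi> k `` {u}"
  note \<tau>l = permutes_tail[OF \<tau>]
  have mem: "c \<in> ?E c"
    using c by (intro equiv_class_self[OF equiv_tail_rel])
  have "?E (\<phi> \<tau> d) = ?E (\<phi> \<tau> c)" if "d \<in> ?E c" for d
  proof -
    obtain \<sigma> where d: "d \<in> C" and \<sigma>: "\<sigma> permutes {1..l}" "\<forall>i\<in>{1..k}. \<sigma> i = i" "c = \<phi> \<sigma> d"
      using \<open>d \<in> ?E c\<close> by (auto simp: tail_rel_def sym_group_carrier)
    let ?\<rho> = "\<tau> \<circ> \<sigma> \<circ> inv' \<tau>"
    have "?\<rho> permutes {1..l}"
      by (intro permutes_compose permutes_inv \<tau>l \<sigma>)
    moreover have "?\<rho> i = i" if "i \<in> {1..k}" for i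
      using \<sigma>(2) that permutes_in_image[OF permutes_inv[OF \<tau>], of i]
      by (simp add: permutes_inverses[OF \<tau>])
    moreover have "\<phi> ?\<rho> (\<phi> \<tau> d) = \<phi> \<tau> c"
      using \<tau>l \<sigma> d by (simp add: comp_act permutes_compose permutes_inv inv_act closed)
    ultimately have "?E (\<phi> \<tau> c) = ?E (\<phi> \<tau> d)"
      by (subst tail_class_eq_iff) (use closed \<tau>l c d in \<open>auto intro!: exI[of _ ?\<rho>]\<close>)
    then show ?thesis by simp
  qed
  moreover have "tail_rel l C \<phi> k `` (\<phi> \<tau> ` ?E c) = (\<Union>u\<in>?E c. ?E (\<phi> \<tau> u))"
    by blast
  ultimately have "tail_rel l C \<phi> k `` (\<phi> \<tau> ` ?E c) = ?E (\<phi> \<tau> c)"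
    using mem by blast
  with c show ?thesis by (simp add: tail_action_def tail_class_in)
qed

end

text \<open>The action preserves the index \<open>l\<close>, so each law is checked inside one
  summand, on a representative of the tail class. This makes the facts about tensor classes
  available for the difference species.\<close>

lemma sym_action_difference:
  fixes C :: "nat \<Rightarrow> 'c set"
  assumes C: "\<And>l. sym_action l (C l) (act l)"
  shows "sym_action n (difference_species C act n) (difference_action C act n)"
proof
  fix \<sigma> u assume \<sigma>: "\<sigma> permutes {1..n}" and "u \<in> difference_species C act n"
  then obtain l K where l: "n < l" and K: "K \<in> tail_quotient l (C l) (act l) n" and u: "u = (l, K)"
    by (auto simp: difference_species_def)
  interpret tail_sym_action l "C l" "act l" n
    using C l by (simp add: tail_sym_action_def tail_sym_action_axioms_def)
  show "difference_action C act n \<sigma> u \<in> difference_species C act n"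
    using K l \<sigma> by (auto simp: difference_species_def difference_action_def u tail_action_class
        closed permutes_tail tail_class_in elim!: tail_quotientE)
next
  fix u assume "u \<in> difference_species C act n"
  then obtain l K where l: "n < l" and K: "K \<in> tail_quotient l (C l) (act l) n" and u: "u = (l, K)"
    by (auto simp: difference_species_def)
  interpret tail_sym_action l "C l" "act l" n
    using C l by (simp add: tail_sym_action_def tail_sym_action_axioms_def)
  show "difference_action C act n id u = u"
    using K l by (auto simp: difference_species_def difference_action_def u tail_action_class
        permutes_id id_act tail_class_in elim!: tail_quotientE)
next
  fix \<sigma> \<tau> u assume \<sigma>: "\<sigma> permutes {1..n}" and \<tau>: "\<tau> permutes {1..n}"
    and "u \<in> difference_species C act n"
  then obtain l K where l: "n < l" and K: "K \<in> tail_quotient l (C l) (act l) n" and u: "u = (l, K)"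
    by (auto simp: difference_species_def)
  interpret tail_sym_action l "C l" "act l" n
    using C l by (simp add: tail_sym_action_def tail_sym_action_axioms_def)
  show "difference_action C act n (\<sigma> \<circ> \<tau>) u =
    difference_action C act n \<sigma> (difference_action C act n \<tau> u)"
    using K l \<sigma> \<tau> by (auto simp: difference_species_def difference_action_def u tail_action_class
        permutes_compose comp_act closed permutes_tail tail_class_in elim!: tail_quotientE)
qed

subsection \<open>Padding tuples by the added point\<close>

text \<open>A normal form with all added points at the end: the old coordinates occupy exactly
  \<open>{1..n}\<close>, the set that the permutations in \<open>tail_rel\<close> fix
  pointwise.\<close>

definition pad :: "nat \<Rightarrow> nat \<Rightarrow> (nat \<Rightarrow> 'a) \<Rightarrow> nat \<Rightarrow> 'a + unit"
  where "pad n l x = (\<lambda>i\<in>{1..l}. if i \<le> n then Inl (x i) else Inr ())"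

lemma pad_in: "n < l \<Longrightarrow> x \<in> {1..n} \<rightarrow>\<^sub>E X \<Longrightarrow> pad n l x \<in> {1..l} \<rightarrow>\<^sub>E plus_one X"
  by (auto simp: pad_def PiE_def Pi_def)

text \<open>Padding is natural because \<open>map_sum f id\<close> fixes the added point.\<close>

lemma compose_map_sum_pad:
  assumes "n < l" "x \<in> {1..n} \<rightarrow>\<^sub>E X"
  shows "compose {1..l} (\<lambda>z\<in>plus_one X. map_sum f id z) (pad n l x) =
    pad n l (compose {1..n} f x)"
  using assms by (intro ext) (auto simp: pad_def compose_def PiE_def Pi_def)

text \<open>Supplies the factor in the smaller symmetric group when a permutation preserves
  \<open>{1..n}\<close>.\<close>

lemma permutes_restrict:
  assumes "\<sigma> permutes S" "T \<subseteq> S" "\<sigma> ` T = T"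
  shows "(\<lambda>i. if i \<in> T then \<sigma> i else i) permutes T"
proof (rule bij_imp_permutes)
  have "inj_on \<sigma> T"
    using assms(1) by (metis permutes_inj inj_on_subset subset_UNIV)
  then show "bij_betw (\<lambda>i. if i \<in> T then \<sigma> i else i) T T"
    using assms(3) by (subst bij_betw_cong[where g = \<sigma>]) (auto simp: bij_betw_def)
qed auto

text \<open>The positions not holding the added point are \<open>{1..m}\<close> in one tuple and
  \<open>{1..n}\<close> in the other. The permutation carries the first set onto the second, and
  counting gives \<open>m = n\<close>.\<close>

lemma pad_related_degree_eq:
  assumes \<sigma>: "\<sigma> permutes {1..l}" and "n < l" "m < l"
    and eq: "\<forall>i\<in>{1..l}. pad m l y i = pad n l x (\<sigma> i)"
  shows "m = n" "\<sigma> ` {1..n} = {1..n}"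
proof -
  have iff: "i \<le> m \<longleftrightarrow> \<sigma> i \<le> n" if "i \<in> {1..l}" for i
    using eq that permutes_in_image[OF \<sigma>, of i] by (auto simp: pad_def split: if_splits)
  have "\<sigma> ` {1..m} = {1..n}"
  proof
    show "\<sigma> ` {1..m} \<subseteq> {1..n}"
    proof
      fix j assume "j \<in> \<sigma> ` {1..m}"
      then obtain i where i: "i \<in> {1..m}" "j = \<sigma> i" by blast
      then have "i \<in> {1..l}" using \<open>m < l\<close> by auto
      with i show "j \<in> {1..n}"
        using iff[of i] permutes_in_image[OF \<sigma>, of i] by simp
    qed
    show "{1..n} \<subseteq> \<sigma> ` {1..m}"
    proof
      fix j assume j: "j \<in> {1..n}"
      then have "j \<in> \<sigma> ` {1..l}"
        using \<open>n < l\<close> by (simp add: permutes_image[OF \<sigma>])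
      then obtain i where "i \<in> {1..l}" "j = \<sigma> i" by blast
      with j iff[of i] show "j \<in> \<sigma> ` {1..m}" by auto
    qed
  qed
  moreover from this have "m = n"
    using card_image[OF inj_on_subset[OF permutes_inj[OF \<sigma>] subset_UNIV], of "{1..m}"] by simp
  ultimately show "m = n" "\<sigma> ` {1..n} = {1..n}" by simp_all
qed

text \<open>Let \<open>S\<close> be the set of positions with old values and \<open>n\<close> its
  size; \<open>n < l\<close> because some position holds the added point. Gluing a bijection from
  \<open>{1..n}\<close> to \<open>S\<close> with one from \<open>{n<..l}\<close> to the complement
  gives the permutation.\<close>

lemma exists_padding_permutation:
  assumes z: "z \<in> {1..l} \<rightarrow>\<^sub>E plus_one X" and ex: "\<exists>i\<in>{1..l}. z i = Inr ()"
  obtains n x \<pi> where "n < l" "x \<in> {1..n} \<rightarrow>\<^sub>E X" "\<pi> permutes {1..l}"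
    "\<forall>i\<in>{1..l}. pad n l x i = z (\<pi> i)"
proof -
  define S where "S = {i\<in>{1..l}. z i \<noteq> Inr ()}"
  define n where "n = card S"
  have fin: "finite S" and sub: "S \<subset> {1..l}"
    using ex by (auto simp: S_def)
  then have n: "n < l"
    unfolding n_def using psubset_card_mono[of "{1..l}" S] by simp
  obtain f where f: "bij_betw f {1..n} S"
    using fin by (metis n_def card_atLeastAtMost diff_Suc_1 finite_atLeastAtMost bij_betw_iff_card)
  have "card {n<..l} = card ({1..l} - S)"
    using fin sub by (subst card_Diff_subset) (auto simp: n_def)
  then obtain g where g: "bij_betw g {n<..l} ({1..l} - S)"
    by (metis finite_Diff finite_atLeastAtMost finite_greaterThanAtMost bij_betw_iff_card)
  \<comment> \<open>Being the identity outside \<open>{1..l}\<close> is part of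
    \<open>permutes\<close>.\<close>
  define \<pi> where "\<pi> i = (if i \<in> {1..l} then if i \<le> n then f i else g i else i)" for i
  have "bij_betw \<pi> {1..n} S"
    using f n by (subst bij_betw_cong[where g = f]) (auto simp: \<pi>_def)
  moreover have "bij_betw \<pi> {n<..l} ({1..l} - S)"
    using g by (subst bij_betw_cong[where g = g]) (auto simp: \<pi>_def)
  ultimately have "bij_betw \<pi> ({1..n} \<union> {n<..l}) (S \<union> ({1..l} - S))"
    by (rule bij_betw_combine) blast
  moreover have "{1..n} \<union> {n<..l} = {1..l}" "S \<union> ({1..l} - S) = {1..l}"
    using n sub by auto
  ultimately have \<pi>: "\<pi> permutes {1..l}"
    by (intro bij_imp_permutes) (auto simp: \<pi>_def)
  have zf: "\<exists>v\<in>X. z (\<pi> i) = Inl v" if "i \<in> {1..n}" for i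
  proof -
    have "\<pi> i \<in> S"
      using that n bij_betwE[OF f] by (auto simp: \<pi>_def)
    with z show ?thesis by (auto simp: S_def PiE_def Pi_def)
  qed
  \<comment> \<open>\<open>projl\<close> is applied only to values of the form \<open>Inl v\<close>,
    by \<open>zf\<close>.\<close>
  define x where "x = (\<lambda>i\<in>{1..n}. projl (z (\<pi> i)))"
  have "x \<in> {1..n} \<rightarrow>\<^sub>E X"
    using zf by (force simp: x_def)
  moreover have "pad n l x i = z (\<pi> i)" if "i \<in> {1..l}" for i
  proof (cases "i \<le> n")
    case True
    with that zf[of i] show ?thesis by (auto simp: pad_def x_def)
  next
    case False
    then have "\<pi> i \<in> {1..l} - S"
      using that bij_betwE[OF g] by (auto simp: \<pi>_def)
    with False that show ?thesis by (auto simp: pad_def S_def)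
  qed
  ultimately show ?thesis using that n \<pi> by blast
qed

section \<open>Comparison of the two congruences\<close>

text \<open>This is the equality of fibres required by \<open>isomorphic_functorsI\<close>. The
  degree \<open>l\<close> is visible on the left and hidden in the summand index on the right; for
  \<open>n\<close> it is the other way round, so each side must recover the other's degree.\<close>

lemma pad_class_eq_iff:
  fixes C :: "nat \<Rightarrow> 'c set"
  assumes C: "\<And>l. sym_action l (C l) (act l)"
    and x: "n < l" "x \<in> {1..n} \<rightarrow>\<^sub>E X" "c \<in> C l" and y: "m < k" "y \<in> {1..m} \<rightarrow>\<^sub>E X" "d \<in> C k"
  shows "(l, tensor_rel l (C l) (act l) (plus_one X) `` {(pad n l x, c)}) =
      (k, tensor_rel k (C k) (act k) (plus_one X) `` {(pad m k y, d)}) \<longleftrightarrow>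
    (n, tensor_rel n (difference_species C act n) (difference_action C act n) X ``
        {(x, l, tail_rel l (C l) (act l) n `` {c})}) =
      (m, tensor_rel m (difference_species C act m) (difference_action C act m) X ``
        {(y, k, tail_rel k (C k) (act k) m `` {d})})"
    (is "?P \<longleftrightarrow> ?Q")
proof (cases "k = l")
  case False
  \<comment> \<open>The left side fails by its first component. The right side fails because
    \<open>difference_action\<close> never changes the summand index, so it cannot relate summands
    \<open>l\<close> and \<open>k\<close>.\<close>
  have "\<not> ?Q"
  proof
    assume Q: ?Q
    then have [simp]: "m = n" by simp
    interpret D: sym_action n "difference_species C act n" "difference_action C act n"
      by (rule sym_action_difference[OF C])
    interpret L: tail_sym_action l "C l" "act l" n
      using C x by (simp add: tail_sym_action_def tail_sym_action_axioms_def)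
    interpret K: tail_sym_action k "C k" "act k" n
      using C y by (simp add: tail_sym_action_def tail_sym_action_axioms_def)
    have "(l, tail_rel l (C l) (act l) n `` {c}) \<in> difference_species C act n"
      "(k, tail_rel k (C k) (act k) n `` {d}) \<in> difference_species C act n"
      using x y by (simp_all add: difference_species_def L.tail_class_in K.tail_class_in)
    with Q x y show False
      using False by (auto simp: D.tensor_class_eq_iff difference_action_def)
  qed
  with False show ?thesis by auto
next
  case [simp]: True
  interpret L: tail_sym_action l "C l" "act l" n
    using C x by (simp add: tail_sym_action_def tail_sym_action_axioms_def)
  interpret D: sym_action n "difference_species C act n" "difference_action C act n"
    by (rule sym_action_difference[OF C])
  let ?E = "\<lambda>c. tail_rel l (C l) (act l) n `` {c}"
  have mem: "(l, ?E b) \<in> difference_species C act n" if "b \<in> C l" for b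
    using that x by (simp add: difference_species_def L.tail_class_in)
  have act_eq: "difference_action C act n \<tau> (l, ?E d) = (l, ?E (act l \<tau> d))"
    if "\<tau> permutes {1..n}" for \<tau>
    using mem[of d] that y by (simp add: difference_action_def L.tail_action_class)
  have P: "?P \<longleftrightarrow> (\<exists>\<sigma>. \<sigma> permutes {1..l} \<and> (\<forall>i\<in>{1..l}. pad m l y i = pad n l x (\<sigma> i)) \<and>
      c = act l \<sigma> d)"
    using x y by (simp add: L.tensor_class_eq_iff pad_in)
  \<comment> \<open>Conditional on \<open>m = n\<close>, since both classes must live in one tensor
    product. Each direction below obtains this equation first.\<close>
  have Q: "?Q \<longleftrightarrow> (\<exists>\<tau>. \<tau> permutes {1..n} \<and> (\<forall>i\<in>{1..n}. y i = x (\<tau> i)) \<and>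
      ?E c = ?E (act l \<tau> d))" if [simp]: "m = n"
    using x y mem by (auto simp: D.tensor_class_eq_iff act_eq)
  show ?thesis
  proof
    assume ?P
    then obtain \<sigma> where \<sigma>: "\<sigma> permutes {1..l}"
      and xy: "\<forall>i\<in>{1..l}. pad m l y i = pad n l x (\<sigma> i)" and c: "c = act l \<sigma> d"
      using P by blast
    have mn [simp]: "m = n" and im: "\<sigma> ` {1..n} = {1..n}"
      using pad_related_degree_eq[OF \<sigma> _ _ xy] x y by simp_all
    define \<tau> where "\<tau> i = (if i \<in> {1..n} then \<sigma> i else i)" for i
    have \<tau>: "\<tau> permutes {1..n}"
      unfolding \<tau>_def using \<sigma> _ im by (rule permutes_restrict) (use x in auto)
    note \<tau>l = L.permutes_tail[OF \<tau>]
    have yx: "y i = x (\<tau> i)" if "i \<in> {1..n}" for i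
    proof -
      have "\<sigma> i \<in> {1..n}" using that im by blast
      then show ?thesis
        using that x xy[rule_format, of i] by (auto simp: pad_def \<tau>_def)
    qed
    \<comment> \<open>Since \<open>\<sigma>\<close> and \<open>\<tau>\<close> agree on
      \<open>{1..n}\<close>, this factor fixes \<open>{1..n}\<close> pointwise, and
      \<open>\<sigma>\<close> is \<open>?\<rho>\<close> after \<open>\<tau>\<close>. So
      \<open>?\<rho>\<close> witnesses equality of the tail classes.\<close>
    let ?\<rho> = "\<sigma> \<circ> inv' \<tau>"
    have \<rho>: "?\<rho> permutes {1..l}"
      by (intro permutes_compose permutes_inv \<sigma> \<tau>l)
    have fix_n: "?\<rho> i = i" if "i \<in> {1..n}" for i
    proof -
      have "inv' \<tau> i \<in> {1..n}"
        using that permutes_in_image[OF permutes_inv[OF \<tau>], of i] by simp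
      then have "\<sigma> (inv' \<tau> i) = \<tau> (inv' \<tau> i)" by (simp add: \<tau>_def)
      then show ?thesis by (simp add: permutes_inverses[OF \<tau>])
    qed
    have "act l ?\<rho> (act l \<tau> d) = c"
      using \<sigma> \<tau>l y c by (simp add: L.comp_act L.inv_act L.closed permutes_inv)
    with \<rho> fix_n have "?E c = ?E (act l \<tau> d)"
      by (subst L.tail_class_eq_iff) (use x y L.closed \<tau>l in \<open>auto intro!: exI[of _ ?\<rho>]\<close>)
    with \<tau> yx show ?Q unfolding Q[OF mn] by blast
  next
    assume Q': ?Q
    then have mn [simp]: "m = n" by simp
    from Q' obtain \<tau> where \<tau>: "\<tau> permutes {1..n}" and yx: "\<forall>i\<in>{1..n}. y i = x (\<tau> i)"
      and E: "?E c = ?E (act l \<tau> d)"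
      using Q by auto
    note \<tau>l = L.permutes_tail[OF \<tau>]
    obtain \<rho> where \<rho>: "\<rho> permutes {1..l}" and fix_n: "\<forall>i\<in>{1..n}. \<rho> i = i"
      and c: "c = act l \<rho> (act l \<tau> d)"
      using E x y L.closed[OF \<tau>l] by (auto simp: L.tail_class_eq_iff)
    \<comment> \<open>As \<open>\<rho>\<close> is injective and fixes \<open>{1..n}\<close>
      pointwise, no later position can enter \<open>{1..n}\<close>: padded positions stay
      padded.\<close>
    have le: "\<rho> i \<le> n \<longleftrightarrow> i \<le> n" if "i \<in> {1..l}" for i
    proof
      assume "\<rho> i \<le> n"
      moreover have "\<rho> i \<in> {1..l}" using that permutes_in_image[OF \<rho>] by blast
      ultimately have "\<rho> (\<rho> i) = \<rho> i" using fix_n by simp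
      then have "\<rho> i = i" using permutes_inj[OF \<rho>] by (simp add: inj_eq)
      with \<open>\<rho> i \<le> n\<close> show "i \<le> n" by simp
    qed (use fix_n that in simp)
    \<comment> \<open>Up to \<open>n\<close>, \<open>\<tau>\<close> stays in \<open>{1..n}\<close>
      and \<open>\<rho>\<close> does nothing; beyond \<open>n\<close>, \<open>\<tau>\<close> does
      nothing and \<open>\<rho>\<close> stays beyond \<open>n\<close>.\<close>
    have "pad n l y i = pad n l x ((\<rho> \<circ> \<tau>) i)" if i: "i \<in> {1..l}" for i
    proof (cases "i \<le> n")
      case True
      with i have "\<tau> i \<in> {1..n}" using permutes_in_image[OF \<tau>, of i] by simp
      with True i yx fix_n x show ?thesis by (simp add: pad_def)
    next
      case False
      then have "\<tau> i = i" using \<tau> by (simp add: permutes_def)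
      with False i le[OF i] permutes_in_image[OF \<rho>, of i] show ?thesis by (simp add: pad_def)
    qed
    moreover have "c = act l (\<rho> \<circ> \<tau>) d"
      using c \<rho> \<tau>l y by (simp add: L.comp_act)
    ultimately show ?P
      unfolding P using permutes_compose[OF \<tau>l \<rho>] by auto
  qed
qed

section \<open>Representatives in analytic functors and the two presentations\<close>

lemma analytic_map_class:
  assumes C: "\<And>l. sym_action l (C l) (act l)"
    and "f \<in> X \<rightarrow> Y" "x \<in> {1..n} \<rightarrow>\<^sub>E X" "c \<in> C n"
  shows "analytic_map C act X Y f (n, tensor_rel n (C n) (act n) X `` {(x, c)}) =
    (n, tensor_rel n (C n) (act n) Y `` {(compose {1..n} f x, c)})"
proof -
  have "tensor_rel n (C n) (act n) X `` {(x, c)} \<in> tensor n (C n) (act n) X"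
    using assms by (auto simp: tensor_def intro: quotientI)
  with assms show ?thesis
    by (simp add: analytic_map_def analytic_def sym_action.tensor_map_class[OF C])
qed

lemma analyticE:
  assumes "u \<in> analytic C act X"
  obtains n x c where "x \<in> {1..n} \<rightarrow>\<^sub>E X" "c \<in> C n"
    "u = (n, tensor_rel n (C n) (act n) X `` {(x, c)})"
  using assms by (auto simp: analytic_def tensor_def elim!: quotientE)

lemma analytic_class_in:
  "x \<in> {1..n} \<rightarrow>\<^sub>E X \<Longrightarrow> c \<in> C n \<Longrightarrow>
    (n, tensor_rel n (C n) (act n) X `` {(x, c)}) \<in> analytic C act X"
  by (auto simp: analytic_def tensor_def intro: quotientI)

text \<open>A class lies outside the image of the injection exactly when its tuples take the added
  point as a value, a property invariant under permuting coordinates. Such a tuple can be brought to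
  padded form.\<close>

lemma difference_analytic_eq:
  fixes X :: "'a set" and C :: "nat \<Rightarrow> 'c set"
  assumes C: "\<And>l. sym_action l (C l) (act l)"
  shows "difference (analytic C act) (analytic C act) (analytic_map C act) X =
    (\<lambda>(n, l, x, c). (l, tensor_rel l (C l) (act l) (plus_one X) `` {(pad n l x, c)})) `
      {(n, l, x, c). n < l \<and> x \<in> {1..n} \<rightarrow>\<^sub>E X \<and> c \<in> C l}"
    (is "?D = ?p ` ?A")
proof (intro equalityI subsetI)
  fix u assume u: "u \<in> ?D"
  then have "u \<in> analytic C act (plus_one X)"
    by (simp add: difference_def)
  then obtain l z c where z: "z \<in> {1..l} \<rightarrow>\<^sub>E plus_one X" and c: "c \<in> C l"
    and u_eq: "u = (l, tensor_rel l (C l) (act l) (plus_one X) `` {(z, c)})"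
    by (rule analyticE)
  interpret sym_action l "C l" "act l" by (rule C)
  have "\<exists>i\<in>{1..l}. z i = Inr ()"
  proof (rule ccontr)
    assume "\<not> ?thesis"
    then have Inl: "\<exists>v\<in>X. z i = Inl v" if "i \<in> {1..l}" for i
      using z that by (auto simp: PiE_def Pi_def)
    \<comment> \<open>If the added point did not occur, \<open>z\<close> would factor through
      \<open>Inl\<close> as this \<open>w\<close>, putting \<open>u\<close> in the image.\<close>
    define w where "w = (\<lambda>i\<in>{1..l}. projl (z i))"
    have w: "w \<in> {1..l} \<rightarrow>\<^sub>E X"
      using Inl by (force simp: w_def)
    have "compose {1..l} (\<lambda>x\<in>X. Inl x) w = z"
    proof (rule extensionalityI)
      show "z \<in> extensional {1..l}" using z by (simp add: PiE_def)
      fix i assume i: "i \<in> {1..l}"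
      then show "compose {1..l} (\<lambda>x\<in>X. Inl x) w i = z i"
        using Inl[OF i] by (auto simp: compose_def w_def)
    qed (simp add: compose_def)
    then have "analytic_map C act X (plus_one X) (\<lambda>x\<in>X. Inl x)
        (l, tensor_rel l (C l) (act l) X `` {(w, c)}) = u"
      using w c by (subst analytic_map_class[OF C]) (auto simp: u_eq)
    with analytic_class_in[of w l X c C act] w c u show False
      by (auto simp: difference_def)
  qed
  with z obtain n x \<pi> where n: "n < l" and x: "x \<in> {1..n} \<rightarrow>\<^sub>E X" and \<pi>: "\<pi> permutes {1..l}"
    and pad: "\<forall>i\<in>{1..l}. pad n l x i = z (\<pi> i)"
    by (rule exists_padding_permutation)
  \<comment> \<open>Reindexing \<open>z\<close> by \<open>\<pi>\<close> must be compensated in the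
    second component: the relation demands \<open>c = act l \<pi> ?d\<close>.\<close>
  let ?d = "act l (inv' \<pi>) c"
  have d: "?d \<in> C l"
    using closed[OF permutes_inv[OF \<pi>] c] .
  have "c = act l \<pi> ?d"
    using inv_act[OF permutes_inv[OF \<pi>] c] by (simp add: permutes_inv_inv[OF \<pi>])
  then have "u = ?p (n, l, x, ?d)"
    using z c d x n \<pi> pad by (auto simp: u_eq tensor_class_eq_iff pad_in)
  with n x d show "u \<in> ?p ` ?A" by blast
next
  fix u assume "u \<in> ?p ` ?A"
  then obtain n l x c where n: "n < l" and x: "x \<in> {1..n} \<rightarrow>\<^sub>E X" and c: "c \<in> C l"
    and u_eq: "u = (l, tensor_rel l (C l) (act l) (plus_one X) `` {(pad n l x, c)})"
    by auto
  interpret sym_action l "C l" "act l" by (rule C)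
  have "u \<in> analytic C act (plus_one X)"
    using n x c by (simp add: u_eq analytic_class_in pad_in)
  moreover have "u \<notin> analytic_map C act X (plus_one X) (\<lambda>x\<in>X. Inl x) ` analytic C act X"
  proof
    assume "u \<in> analytic_map C act X (plus_one X) (\<lambda>x\<in>X. Inl x) ` analytic C act X"
    then obtain v where v: "v \<in> analytic C act X"
      and uv: "u = analytic_map C act X (plus_one X) (\<lambda>x\<in>X. Inl x) v" by blast
    from v obtain k w d where w: "w \<in> {1..k} \<rightarrow>\<^sub>E X" "d \<in> C k"
      and v_eq: "v = (k, tensor_rel k (C k) (act k) X `` {(w, d)})"
      by (rule analyticE)
    let ?w = "compose {1..k} (\<lambda>x\<in>X. Inl x :: 'a + unit) w"
    have eq: "u = (k, tensor_rel k (C k) (act k) (plus_one X) `` {(?w, d)})"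
      unfolding uv v_eq using w by (intro analytic_map_class[OF C]) auto
    then have [simp]: "k = l" by (simp add: u_eq)
    have w': "?w \<in> {1..l} \<rightarrow>\<^sub>E plus_one X"
      using w by (auto simp: compose_def PiE_def Pi_def)
    have "tensor_rel l (C l) (act l) (plus_one X) `` {(?w, d)} =
        tensor_rel l (C l) (act l) (plus_one X) `` {(pad n l x, c)}"
      using eq by (simp add: u_eq)
    then obtain \<sigma> where \<sigma>: "\<sigma> permutes {1..l}" "\<forall>i\<in>{1..l}. pad n l x i = ?w (\<sigma> i)"
      using tensor_class_eq_iff[OF w' pad_in[OF n x]] w c by auto
    \<comment> \<open>Position \<open>l\<close> is padded because \<open>n < l\<close>, whereas
      every coordinate of \<open>?w\<close> is an \<open>Inl\<close>.\<close>
    have "l \<in> {1..l}" using n by simp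
    then have "pad n l x l = ?w (\<sigma> l)" and "\<sigma> l \<in> {1..l}"
      using \<sigma> permutes_in_image[OF \<sigma>(1), of l] by blast+
    with n w show False
      by (auto simp: pad_def compose_def PiE_def Pi_def split: if_splits)
  qed
  ultimately show "u \<in> ?D" by (simp add: difference_def)
qed

text \<open>Representatives are chosen twice: for the tensor class, and then for the tail class in
  its second component.\<close>

lemma analytic_difference_species_eq:
  fixes X :: "'a set" and C :: "nat \<Rightarrow> 'c set"
  assumes C: "\<And>l. sym_action l (C l) (act l)"
  shows "analytic (difference_species C act) (difference_action C act) X =
    (\<lambda>(n, l, x, c). (n, tensor_rel n (difference_species C act n) (difference_action C act n) X ``
        {(x, l, tail_rel l (C l) (act l) n `` {c})})) `
      {(n, l, x, c). n < l \<and> x \<in> {1..n} \<rightarrow>\<^sub>E X \<and> c \<in> C l}"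
    (is "?G = ?q ` ?A")
proof (intro equalityI subsetI)
  fix u assume "u \<in> ?G"
  then obtain n x e where x: "x \<in> {1..n} \<rightarrow>\<^sub>E X" and e: "e \<in> difference_species C act n"
    and u: "u = (n, tensor_rel n (difference_species C act n) (difference_action C act n) X ``
      {(x, e)})"
    by (rule analyticE)
  from e obtain l c where "n < l" "c \<in> C l" "e = (l, tail_rel l (C l) (act l) n `` {c})"
    by (auto simp: difference_species_def tail_quotient_def elim!: quotientE)
  with x have "(n, l, x, c) \<in> ?A" "u = ?q (n, l, x, c)"
    by (auto simp: u)
  then show "u \<in> ?q ` ?A" by blast
next
  fix u assume "u \<in> ?q ` ?A"
  then obtain n l x c where "n < l" and x: "x \<in> {1..n} \<rightarrow>\<^sub>E X" and "c \<in> C l"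
    and u: "u = ?q (n, l, x, c)" by blast
  then have "(l, tail_rel l (C l) (act l) n `` {c}) \<in> difference_species C act n"
    by (simp add: difference_species_def tail_quotient_def quotientI)
  with x show "u \<in> ?G" by (simp add: u analytic_class_in)
qed

section \<open>The isomorphism between the difference and the analytic functor\<close>

theorem corollary4p3p2:
  fixes C :: "nat \<Rightarrow> 'c set"
    and act :: "nat \<Rightarrow> (nat \<Rightarrow> nat) \<Rightarrow> 'c \<Rightarrow> 'c"
  assumes "species C act"
  shows "isomorphic_functors
    (difference (analytic C act) (analytic C act) (analytic_map C act)
       :: 'a set \<Rightarrow> (nat \<times> ((nat \<Rightarrow> 'a + unit) \<times> 'c) set) set)
    (difference_map (analytic C act) (analytic C act) (analytic_map C act) (analytic_map C act))
    (analytic (difference_species C act) (difference_action C act))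
    (analytic_map (difference_species C act) (difference_action C act))"
proof -
  have C: "sym_action l (C l) (act l)" for l
    using assms by (simp add: species_def sym_action_of_group_action)
  let ?A = "\<lambda>X :: 'a set. {(n, l, x, c). n < l \<and> x \<in> {1..n} \<rightarrow>\<^sub>E X \<and> c \<in> C l}"
  \<comment> \<open>Only the unpadded coordinates vary with \<open>f\<close>; this is the action on
    the common functor \<open>?A\<close>.\<close>
  let ?m = "\<lambda>(f :: 'a \<Rightarrow> 'a) (n, l, x, c). (n, l, compose {1..n} f x, c)"
  show ?thesis
  proof (rule isomorphic_functorsI[OF difference_analytic_eq[OF C]
        analytic_difference_species_eq[OF C], where m = ?m])
    fix X :: "'a set" and a b assume "a \<in> ?A X" "b \<in> ?A X"
    then show "(case a of (n, l, x, c) \<Rightarrow>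
          (l, tensor_rel l (C l) (act l) (plus_one X) `` {(pad n l x, c)})) =
        (case b of (n, l, x, c) \<Rightarrow>
          (l, tensor_rel l (C l) (act l) (plus_one X) `` {(pad n l x, c)})) \<longleftrightarrow>
      (case a of (n, l, x, c) \<Rightarrow>
          (n, tensor_rel n (difference_species C act n) (difference_action C act n) X ``
            {(x, l, tail_rel l (C l) (act l) n `` {c})})) =
        (case b of (n, l, x, c) \<Rightarrow>
          (n, tensor_rel n (difference_species C act n) (difference_action C act n) X ``
            {(x, l, tail_rel l (C l) (act l) n `` {c})}))"
      by (clarsimp simp only: mem_Collect_eq case_prod_conv) (rule pad_class_eq_iff[OF C])
  next
    fix X Y :: "'a set" and f a assume f: "f \<in> X \<rightarrow>\<^sub>E Y" and a: "a \<in> ?A X"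
    obtain n l x c where a_eq: "a = (n, l, x, c)" by (cases a)
    with a have x: "n < l" "x \<in> {1..n} \<rightarrow>\<^sub>E X" "c \<in> C l" by auto
    then have "compose {1..n} f x \<in> {1..n} \<rightarrow>\<^sub>E Y"
      using f by (auto simp: compose_def PiE_def Pi_def)
    with x show m: "?m f a \<in> ?A Y" by (simp add: a_eq)
    have "(\<lambda>z\<in>plus_one X. map_sum f id z) \<in> plus_one X \<rightarrow> plus_one Y"
      using f by auto
    then have "analytic_map C act (plus_one X) (plus_one Y) (\<lambda>z\<in>plus_one X. map_sum f id z)
        (l, tensor_rel l (C l) (act l) (plus_one X) `` {(pad n l x, c)}) =
      (l, tensor_rel l (C l) (act l) (plus_one Y) `` {(pad n l (compose {1..n} f x), c)})"
      using x by (simp add: analytic_map_class[OF C] pad_in compose_map_sum_pad)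
    \<comment> \<open>Needed because \<open>difference_map\<close> is a restriction to the
      difference and agrees with \<open>analytic_map\<close> only there.\<close>
    moreover have "(l, tensor_rel l (C l) (act l) (plus_one X) `` {(pad n l x, c)}) \<in>
        difference (analytic C act) (analytic C act) (analytic_map C act) X"
      unfolding difference_analytic_eq[OF C] using x
      by (intro image_eqI[of _ _ "(n, l, x, c)"]) simp_all
    ultimately show "difference_map (analytic C act) (analytic C act) (analytic_map C act)
        (analytic_map C act) X Y f (case a of (n, l, x, c) \<Rightarrow>
          (l, tensor_rel l (C l) (act l) (plus_one X) `` {(pad n l x, c)})) =
      (case ?m f a of (n, l, x, c) \<Rightarrow>
          (l, tensor_rel l (C l) (act l) (plus_one Y) `` {(pad n l x, c)}))"
      by (simp add: difference_map_def a_eq)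
    have "(l, tail_rel l (C l) (act l) n `` {c}) \<in> difference_species C act n"
      using x by (auto simp: difference_species_def tail_quotient_def intro: quotientI)
    then show "analytic_map (difference_species C act) (difference_action C act) X Y f
        (case a of (n, l, x, c) \<Rightarrow>
          (n, tensor_rel n (difference_species C act n) (difference_action C act n) X ``
            {(x, l, tail_rel l (C l) (act l) n `` {c})})) =
      (case ?m f a of (n, l, x, c) \<Rightarrow>
          (n, tensor_rel n (difference_species C act n) (difference_action C act n) Y ``
            {(x, l, tail_rel l (C l) (act l) n `` {c})}))"
      unfolding a_eq prod.case using f x
      by (intro analytic_map_class[OF sym_action_difference[OF C]]) auto
  next
    fix X :: "'a set" and a assume "a \<in> ?A X"
    then show "?m (\<lambda>x\<in>X. x) a = a"
      by (auto simp: PiE_def intro!: Id_compose)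
  next
    fix X Y Z :: "'a set" and f g a assume "f \<in> X \<rightarrow>\<^sub>E Y" "g \<in> Y \<rightarrow>\<^sub>E Z" "a \<in> ?A X"
    then show "?m (compose X g f) a = ?m g (?m f a)"
      by (auto simp: compose_def PiE_def Pi_def fun_eq_iff)
  next
    fix X Y :: "'a set" and f
    show "difference_map (analytic C act) (analytic C act) (analytic_map C act)
        (analytic_map C act) X Y f \<in>
      extensional (difference (analytic C act) (analytic C act) (analytic_map C act) X)"
      by (simp add: difference_map_def)
    show "analytic_map (difference_species C act) (difference_action C act) X Y f \<in>
      extensional (analytic (difference_species C act) (difference_action C act) X)"
      by (simp add: analytic_map_def)
  qed
qed

end
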